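(* There exist a function $\hat\lambda(\cdot)$ such that for each state $s$ at which the CMDP "$\max_{\pi\in\Delta} V^\pi_{r,1}(s)$ s.t. $V^\pi_{c,1}(s)\le 0$" is feasible, $$\hat\lambda(s)\in\arg\min_{y\ge 0}\Big(\max_{\pi\in\Delta} V^\pi_{r,1}(s)-y\,V^\pi_{c,1}(s)\Big),$$ and a Markovian policy $\pi^*\in\Delta$, such that $(\pi^*,\hat\lambda)$ is a saddle-point to the CMDPs $\max_{\pi\in\Delta}V^\pi_{r,1}(s_1)$ s.t. $V^\pi_{c,1}(s_1)\le 0$ simultaneously for all initial states $s_1\in\mathcal{S}$ for which the CMDP is feasible. That is, for all $\pi\in\Delta$, all $\lambda:\mathcal{S}\to\mathbb{R}$, and all such $s_1\in\mathcal{S}$, $$V^{\pi^*}_{r,1}(s_1)-\lambda(s_1)V^{\pi^*}_{c,1}(s_1)\ \ge\ V^{\pi^*}_{r,1}(s_1)-\hat\lambda(s_1)V^{\pi^*}_{c,1}(s_1)\ \ge\ V^{\pi}_{r,1}(s_1)-\hat\lambda(s_1)V^{\pi}_{c,1}(s_1).$$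
   Context: Setting. $(\mathcal{S},\mathcal{A},P,r,H)$ is a finite-horizon MDP with state space $\mathcal{S}$ (possibly large or continuous), action space $\mathcal{A}$ (relatively small, so that maxima over $a\in\mathcal{A}$ can be performed), transition dynamics $P=\{P_h\}_{h=1}^H$, deterministic rewards $r=\{r_h\}_{h=1}^H$ with $r_h:\mathcal{S}\times\mathcal{A}\to[0,1]$, and horizon $H$. The state space is layered: a state at time $h$ has the form $(\bar s,h)$. $\mathcal{S}_{reset}\subseteq\mathcal{S}$ is the set of reset states (membership depends only on the time-invariant part $\bar s$). The cost is $c_h(s,a)=\mathds{1}[s\in\mathcal{S}_{reset}]$. $\mathcal{S}$ contains a fictitious absorbing state $s^\dagger$ with $r_h(s^\dagger,a)=c_h(s^\dagger,a)=0$; from $s^\dagger$ the agent stays at $s^\dagger$ until the end of the episode, and from any $s\in\mathcal{S}_{reset}$ every action leads to $s^\dagger$ in the next step. (So the total cost in an episode is $0$ or $1$.) $\Delta$ is the set of Markovian policies $\pi=\{\pi_h(a_h|s_h)\}_{h=1}^H$ (possibly randomized). For $g\in\{r,c\}$, $V^\pi_{g,h}(s)=\mathbb{E}_\pi[\sum_{t=h}^H g_t(s_t,a_t)\mid s_h=s]$. The CMDP with initial state $s_1$ is feasible if there is $\pi\in\Delta$ with $V^\pi_{c,1}(s_1)\le 0$.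
   Formalization: If some transition is not supported on finitely many states, the formal theorem assumes that the minimum over y ≥ 0 is attained at every feasible state; without this the argmin can be empty on infinite state spaces and the claim fails. Finite state spaces need no such assumption. *)

theory Defs
  imports "HOL-Probability.Probability"
begin

(* The state (x, h) of the layered state space is represented by its time-invariant part
   x together with the time index h, which every operation below takes as an explicit
   argument.  So "states" is the space of time-invariant parts, membership in the reset set
   depends on that part only, and an initial state (x, 1) is given by x.
   "sink" is the fictitious absorbing state. *)
record ('s, 'a) cmdp =
  states :: "'s measure"
  actions :: "'a set"
  trans :: "nat \<Rightarrow> 's \<Rightarrow> 'a \<Rightarrow> 's measure"
  reward :: "nat \<Rightarrow> 's \<Rightarrow> 'a \<Rightarrow> real"
  horizon :: nat
  reset :: "'s set"
  sink :: 's

definition cost :: "('s, 'a) cmdp \<Rightarrow> nat \<Rightarrow> 's \<Rightarrow> 'a \<Rightarrow> real" where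
  "cost M h s a = indicator (reset M) s"

locale reset_cmdp =
  fixes M :: "('s, 'a) cmdp"
  assumes finite_actions: "finite (actions M)"
    and actions_nonempty: "actions M \<noteq> {}"
    and trans_kernel: "\<And>h a. h \<in> {1..horizon M} \<Longrightarrow> a \<in> actions M \<Longrightarrow>
      (\<lambda>s. trans M h s a) \<in> states M \<rightarrow>\<^sub>M prob_algebra (states M)"
    and reward_measurable: "\<And>h a. h \<in> {1..horizon M} \<Longrightarrow> a \<in> actions M \<Longrightarrow>
      (\<lambda>s. reward M h s a) \<in> borel_measurable (states M)"
    and reward_range: "\<And>h s a. h \<in> {1..horizon M} \<Longrightarrow> s \<in> space (states M) \<Longrightarrow>
      a \<in> actions M \<Longrightarrow> reward M h s a \<in> {0..1}"
    and reset_measurable: "reset M \<in> sets (states M)"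
    and sink_state: "sink M \<in> space (states M)"
    and sink_cost: "\<And>h a. h \<in> {1..horizon M} \<Longrightarrow> a \<in> actions M \<Longrightarrow> cost M h (sink M) a = 0"
    and sink_reward: "\<And>h a. h \<in> {1..horizon M} \<Longrightarrow> a \<in> actions M \<Longrightarrow> reward M h (sink M) a = 0"
    and sink_absorbing: "\<And>h a. h \<in> {1..horizon M} \<Longrightarrow> a \<in> actions M \<Longrightarrow>
      trans M h (sink M) a = return (states M) (sink M)"
    and reset_to_sink: "\<And>h s a. h \<in> {1..horizon M} \<Longrightarrow> s \<in> reset M \<Longrightarrow> a \<in> actions M \<Longrightarrow>
      trans M h s a = return (states M) (sink M)"

definition policies :: "('s, 'a) cmdp \<Rightarrow> (nat \<Rightarrow> 's \<Rightarrow> 'a measure) set" where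
  "policies M = {\<pi>. \<forall>h\<in>{1..horizon M}.
     \<pi> h \<in> states M \<rightarrow>\<^sub>M prob_algebra (count_space (actions M))}"

abbreviation traj_space :: "('s, 'a) cmdp \<Rightarrow> nat \<Rightarrow> (nat \<Rightarrow> 's \<times> 'a) measure" where
  "traj_space M h \<equiv> PiM {h..horizon M} (\<lambda>_. states M \<Otimes>\<^sub>M count_space (actions M))"

(* Law of the state-action pairs (s_t, a_t), t = h, ..., H, under a policy, given s_h = s. *)
function traj :: "('s, 'a) cmdp \<Rightarrow> (nat \<Rightarrow> 's \<Rightarrow> 'a measure) \<Rightarrow> nat \<Rightarrow> 's \<Rightarrow> (nat \<Rightarrow> 's \<times> 'a) measure"
  where
  "traj M \<pi> h s =
    (if h \<le> horizon M then
       do {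
         a \<leftarrow> \<pi> h s;
         s' \<leftarrow> trans M h s a;
         \<omega> \<leftarrow> traj M \<pi> (Suc h) s';
         return (traj_space M h) (fun_upd \<omega> h (s, a))
       }
     else return (traj_space M h) (\<lambda>_. undefined))"
  by auto
termination
  by (relation "Wellfounded.measure (\<lambda>(M, \<pi>, h, s). Suc (horizon M) - h)") auto

declare traj.simps [simp del]

definition policy_value ::
    "('s, 'a) cmdp \<Rightarrow> (nat \<Rightarrow> 's \<Rightarrow> 'a measure) \<Rightarrow> (nat \<Rightarrow> 's \<Rightarrow> 'a \<Rightarrow> real) \<Rightarrow> nat \<Rightarrow> 's \<Rightarrow> real"
  where
  "policy_value M \<pi> g h s =
     (\<integral>\<omega>. (\<Sum>t=h..horizon M. g t (fst (\<omega> t)) (snd (\<omega> t))) \<partial>traj M \<pi> h s)"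

definition feasible :: "('s, 'a) cmdp \<Rightarrow> 's \<Rightarrow> bool" where
  "feasible M s \<longleftrightarrow> (\<exists>\<pi>\<in>policies M. policy_value M \<pi> (cost M) 1 s \<le> 0)"

definition lagrangian :: "('s, 'a) cmdp \<Rightarrow> 's \<Rightarrow> (nat \<Rightarrow> 's \<Rightarrow> 'a measure) \<Rightarrow> real \<Rightarrow> real" where
  "lagrangian M s \<pi> y =
     policy_value M \<pi> (reward M) 1 s - y * policy_value M \<pi> (cost M) 1 s"

definition dual_fun :: "('s, 'a) cmdp \<Rightarrow> 's \<Rightarrow> real \<Rightarrow> real" where
  "dual_fun M s y = (SUP \<pi>\<in>policies M. lagrangian M s \<pi> y)"

(* Holds for every finite state space, and for deterministic dynamics on any state space
   with measurable singletons.  Without it the infimum of dual_fun over y >= 0 need not be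
   attained: let the initial state lead to state i with probability 2^-i, where a safe action
   earns 0 and a risky one earns 1 but leads to a reset with probability 4^-i.  Then dual_fun
   is positive everywhere, with infimum 0. *)
definition finitely_branching :: "('s, 'a) cmdp \<Rightarrow> bool" where
  "finitely_branching M \<longleftrightarrow>
     (\<forall>h\<in>{1..horizon M}. \<forall>s\<in>space (states M). \<forall>a\<in>actions M.
        \<exists>F. finite F \<and> (AE s' in trans M h s a. s' \<in> F))"

end

theory Submission
  imports Defs
begin

text \<open>For a fixed multiplier the dual function is the optimal value of the unconstrained problem
  with reward \<open>r - y c\<close>, computed by backward induction. A state is safe if the minimal expected
  cost from it is zero; the safe value is the optimal reward among actions that keep this minimal
  cost at zero, and one greedy policy attains it from all safe states simultaneously, at zero cost.
  Every other action makes the dual value at most the horizon minus a positive multiple of \<open>y\<close>, so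
  along \<open>y = 0, 1, 2, \<dots>\<close> the dual function decreases to the safe value: there is no duality gap,
  and any dual minimiser together with the greedy policy is a saddle point. Under finite branching
  the safe value is reached at some finite \<open>y\<close>, so the minimum exists.\<close>

lemma measurable_finite_selection:
  fixes A :: "'a set" and N :: "'s measure"
  assumes fin: "finite A"
    and pred: "\<And>a. a \<in> A \<Longrightarrow> Measurable.pred N (\<lambda>s. P s a)"
    and ex: "\<And>s. s \<in> space N \<Longrightarrow> \<exists>a\<in>A. P s a"
  obtains f where "f \<in> N \<rightarrow>\<^sub>M count_space A" "\<And>s. s \<in> space N \<Longrightarrow> P s (f s)"
proof -
  obtain e where e: "bij_betw e {..<card A} A"
    using ex_bij_betw_nat_finite[OF fin] by (auto simp: atLeast0LessThan)
  define k where "k s = (LEAST j. j < card A \<and> P s (e j))" for s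
  have "Measurable.pred N (\<lambda>s. j < card A \<and> P s (e j))" for j
    using pred[of "e j"] bij_betw_apply[OF e, of j] by (cases "j < card A") auto
  then have "k \<in> N \<rightarrow>\<^sub>M count_space UNIV"
    unfolding k_def by (rule measurable_Least)
  then have meas: "(\<lambda>s. e (k s)) \<in> N \<rightarrow>\<^sub>M count_space UNIV"
    by (rule measurable_compose) simp
  have k: "k s < card A \<and> P s (e (k s))" if s: "s \<in> space N" for s
  proof -
    obtain j where "j < card A" "P s (e j)"
      using ex[OF s] bij_betw_imp_surj_on[OF e] by (metis imageE lessThan_iff)
    then show ?thesis
      unfolding k_def by (intro LeastI[where P="\<lambda>j. j < card A \<and> P s (e j)"]) simp
  qed
  have "(\<lambda>s. e (k s)) \<in> N \<rightarrow>\<^sub>M count_space A"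
    using meas k bij_betw_apply[OF e] fin
    by (auto simp: measurable_count_space_eq2 measurable_count_space_eq2_countable)
  then show thesis
    using k that by blast
qed

lemma integral_bind_prob:
  fixes f :: "'b \<Rightarrow> real"
  assumes "f \<in> borel_measurable K" "\<And>x. x \<in> space K \<Longrightarrow> \<bar>f x\<bar> \<le> B"
    and N: "N \<in> L \<rightarrow>\<^sub>M prob_algebra K" and "prob_space L"
  shows "(\<integral>x. f x \<partial>(L \<bind> N)) = (\<integral>x. \<integral>y. f y \<partial>N x \<partial>L)"
proof (rule integral_bind[where B=B and B'=1])
  show "N \<in> L \<rightarrow>\<^sub>M subprob_algebra K"
    using N by (rule measurable_prob_algebraD)
  show "finite_measure L"
    using \<open>prob_space L\<close> by (simp add: prob_space.finite_measure)
  show "AE x in L. emeasure (N x) (space (N x)) \<le> ennreal 1"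
    using measurable_space[OF N]
    by (intro AE_I2) (simp add: space_prob_algebra prob_space.emeasure_space_1)
qed fact+

definition backup ::
    "('s, 'a) cmdp \<Rightarrow> (nat \<Rightarrow> 's \<Rightarrow> 'a \<Rightarrow> real) \<Rightarrow> nat \<Rightarrow> ('s \<Rightarrow> real) \<Rightarrow> 's \<Rightarrow> 'a \<Rightarrow> real" where
  "backup M g h f s a = g h s a + (\<integral>s'. f s' \<partial>trans M h s a)"

function opt_value :: "('s, 'a) cmdp \<Rightarrow> (nat \<Rightarrow> 's \<Rightarrow> 'a \<Rightarrow> real) \<Rightarrow> nat \<Rightarrow> 's \<Rightarrow> real" where
  "opt_value M g h s =
    (if h \<le> horizon M then Max (backup M g h (\<lambda>s'. opt_value M g (Suc h) s') s ` actions M) else 0)"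
  by auto
termination
  by (relation "Wellfounded.measure (\<lambda>(M, g, h, s). Suc (horizon M) - h)") auto

declare opt_value.simps [simp del]

context reset_cmdp
begin

definition bounded_measurable :: "('s \<Rightarrow> real) \<Rightarrow> bool" where
  "bounded_measurable f \<longleftrightarrow>
     f \<in> borel_measurable (states M) \<and> (\<exists>B. \<forall>s\<in>space (states M). \<bar>f s\<bar> \<le> B)"

definition stage_function :: "(nat \<Rightarrow> 's \<Rightarrow> 'a \<Rightarrow> real) \<Rightarrow> bool" where
  "stage_function g \<longleftrightarrow> (\<forall>h\<in>{1..horizon M}. \<forall>a\<in>actions M. bounded_measurable (\<lambda>s. g h s a))"

lemma bounded_measurable_add:
  assumes "bounded_measurable f" "bounded_measurable g"
  shows "bounded_measurable (\<lambda>s. f s + g s)"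
proof -
  obtain B C where "\<forall>s\<in>space (states M). \<bar>f s\<bar> \<le> B" "\<forall>s\<in>space (states M). \<bar>g s\<bar> \<le> C"
    using assms by (auto simp: bounded_measurable_def)
  then have "\<forall>s\<in>space (states M). \<bar>f s + g s\<bar> \<le> B + C"
    by (smt (verit))
  then show ?thesis
    using assms by (auto simp: bounded_measurable_def)
qed

lemma bounded_measurable_cmult:
  assumes "bounded_measurable f"
  shows "bounded_measurable (\<lambda>s. c * f s)"
proof -
  obtain B where "\<forall>s\<in>space (states M). \<bar>f s\<bar> \<le> B"
    using assms by (auto simp: bounded_measurable_def)
  then have "\<forall>s\<in>space (states M). \<bar>c * f s\<bar> \<le> \<bar>c\<bar> * B"
    by (simp add: abs_mult mult_left_mono)
  then show ?thesis
    using assms by (auto simp: bounded_measurable_def)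
qed

lemma trans_space:
  assumes "h \<in> {1..horizon M}" "a \<in> actions M" "s \<in> space (states M)"
  shows "prob_space (trans M h s a)" "sets (trans M h s a) = sets (states M)"
    "space (trans M h s a) = space (states M)"
  using measurable_space[OF trans_kernel[OF assms(1,2)] assms(3)]
  by (auto simp: space_prob_algebra dest: sets_eq_imp_space_eq)

lemma policy_space:
  assumes "\<pi> \<in> policies M" "h \<in> {1..horizon M}" "s \<in> space (states M)"
  shows "prob_space (\<pi> h s)" "sets (\<pi> h s) = Pow (actions M)" "space (\<pi> h s) = actions M"
proof -
  have "\<pi> h s \<in> space (prob_algebra (count_space (actions M)))"
    using assms by (intro measurable_space[of "\<pi> h"]) (auto simp: policies_def)
  then show "prob_space (\<pi> h s)" "sets (\<pi> h s) = Pow (actions M)" "space (\<pi> h s) = actions M"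
    using sets_eq_imp_space_eq[of "\<pi> h s" "count_space (actions M)"]
    by (auto simp: space_prob_algebra)
qed

lemma integrable_trans:
  assumes "h \<in> {1..horizon M}" "a \<in> actions M" "s \<in> space (states M)" "bounded_measurable f"
  shows "integrable (trans M h s a) f"
proof -
  interpret P: prob_space "trans M h s a"
    by (rule trans_space) fact+
  obtain B where "\<forall>s\<in>space (states M). \<bar>f s\<bar> \<le> B"
    using assms by (auto simp: bounded_measurable_def)
  moreover have "f \<in> borel_measurable (trans M h s a)"
    using assms(4) measurable_cong_sets[OF trans_space(2)[OF assms(1-3)] refl]
    by (auto simp: bounded_measurable_def)
  ultimately show ?thesis
    using trans_space(3)[OF assms(1-3)] by (intro P.integrable_const_bound[where B=B]) auto
qed

lemma integrable_policy:
  fixes f :: "'a \<Rightarrow> real"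
  assumes "\<pi> \<in> policies M" "h \<in> {1..horizon M}" "s \<in> space (states M)"
  shows "integrable (\<pi> h s) f"
proof -
  interpret P: prob_space "\<pi> h s"
    by (rule policy_space) fact+
  have "AE a in \<pi> h s. norm (f a) \<le> (\<Sum>a\<in>actions M. norm (f a))"
    using policy_space(3)[OF assms] finite_actions
    by (intro AE_I2 member_le_sum) auto
  moreover have "f \<in> borel_measurable (\<pi> h s)"
    using policy_space(2,3)[OF assms] by (auto simp: measurable_def)
  ultimately show ?thesis
    by (rule P.integrable_const_bound)
qed

lemma bounded_measurable_integral_kernel:
  fixes g :: "'b \<Rightarrow> real"
  assumes K: "K \<in> states M \<rightarrow>\<^sub>M prob_algebra N" and g: "g \<in> borel_measurable N"
    and B: "\<And>x. x \<in> space N \<Longrightarrow> \<bar>g x\<bar> \<le> B"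
  shows "bounded_measurable (\<lambda>s. \<integral>x. g x \<partial>K s)"
  unfolding bounded_measurable_def
proof (intro conjI exI ballI)
  show "(\<lambda>s. \<integral>x. g x \<partial>K s) \<in> borel_measurable (states M)"
    by (rule measurable_compose[OF measurable_prob_algebraD[OF K] integral_measurable_subprob_algebra[OF g]])
  fix s assume "s \<in> space (states M)"
  then have "prob_space (K s)" and sets: "sets (K s) = sets N"
    using measurable_space[OF K] by (auto simp: space_prob_algebra)
  then interpret P: prob_space "K s" by simp
  have sp: "space (K s) = space N"
    using sets by (rule sets_eq_imp_space_eq)
  have "integrable (K s) g"
    using B g sp sets by (intro P.integrable_const_bound[where B=B]) (auto simp: measurable_cong_sets[OF sets refl])
  moreover have "AE x in K s. g x \<le> B" "AE x in K s. - B \<le> g x"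
    using B sp by (auto intro!: AE_I2 simp: abs_le_iff minus_le_iff)
  ultimately have "(\<integral>x. g x \<partial>K s) \<le> B" "- B \<le> (\<integral>x. g x \<partial>K s)"
    by (simp_all add: P.integral_le_const P.integral_ge_const)
  then show "\<bar>\<integral>x. g x \<partial>K s\<bar> \<le> B" by simp
qed

lemma bounded_measurable_backup:
  assumes "stage_function g" "h \<in> {1..horizon M}" "a \<in> actions M" "bounded_measurable f"
  shows "bounded_measurable (\<lambda>s. backup M g h f s a)"
proof -
  obtain B where "\<forall>s\<in>space (states M). \<bar>f s\<bar> \<le> B"
    using assms by (auto simp: bounded_measurable_def)
  then show ?thesis
    using assms unfolding backup_def
    by (intro bounded_measurable_add bounded_measurable_integral_kernel[OF trans_kernel])
      (auto simp: stage_function_def bounded_measurable_def)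
qed

lemma backward_induct [consumes 1, case_names terminal step]:
  assumes "1 \<le> h"
    and "\<And>h. horizon M < h \<Longrightarrow> P h"
    and "\<And>h. h \<in> {1..horizon M} \<Longrightarrow> P (Suc h) \<Longrightarrow> P h"
  shows "P h"
  using assms(1)
proof (induction "Suc (horizon M) - h" arbitrary: h)
  case 0
  then show ?case by (intro assms(2)) simp
next
  case (Suc k)
  show ?case
  proof (rule assms(3))
    show "h \<in> {1..horizon M}"
      using Suc.hyps(2) Suc.prems by simp
    show "P (Suc h)"
      using Suc.hyps(2) by (intro Suc.hyps(1)) simp_all
  qed
qed

lemma state_action_measurable:
  assumes "\<And>a. a \<in> actions M \<Longrightarrow> (\<lambda>s. f s a) \<in> states M \<rightarrow>\<^sub>M N"
  shows "(\<lambda>p. f (fst p) (snd p)) \<in> states M \<Otimes>\<^sub>M count_space (actions M) \<rightarrow>\<^sub>M N"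
  by (rule measurable_compose_countable'[where g=snd and I="actions M" and f="\<lambda>a p. f (fst p) a"])
    (auto intro!: measurable_compose[OF measurable_fst assms] countable_finite finite_actions)

lemma traj_update_measurable:
  assumes "h \<in> {1..horizon M}"
  shows "(\<lambda>q. (snd q)(h := fst q)) \<in>
      (states M \<Otimes>\<^sub>M count_space (actions M)) \<Otimes>\<^sub>M traj_space M (Suc h) \<rightarrow>\<^sub>M traj_space M h"
  using assms by (intro measurable_fun_upd[where J="{Suc h..horizon M}"]) auto

lemma traj_tail_kernel:
  assumes h: "h \<in> {1..horizon M}"
    and tail: "traj M \<pi> (Suc h) \<in> states M \<rightarrow>\<^sub>M prob_algebra (traj_space M (Suc h))"
  shows "(\<lambda>(p, s'). traj M \<pi> (Suc h) s' \<bind> (\<lambda>\<omega>. return (traj_space M h) (fun_upd \<omega> h p))) \<in>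
      (states M \<Otimes>\<^sub>M count_space (actions M)) \<Otimes>\<^sub>M states M \<rightarrow>\<^sub>M prob_algebra (traj_space M h)"
    (is ?tail)
  and "(\<lambda>(s, a). trans M h s a \<bind> (\<lambda>s'. traj M \<pi> (Suc h) s' \<bind>
      (\<lambda>\<omega>. return (traj_space M h) (fun_upd \<omega> h (s, a))))) \<in>
      states M \<Otimes>\<^sub>M count_space (actions M) \<rightarrow>\<^sub>M prob_algebra (traj_space M h)" (is ?trans)
proof -
  have "(\<lambda>q. (fst (fst q), snd q)) \<in>
      ((states M \<Otimes>\<^sub>M count_space (actions M)) \<Otimes>\<^sub>M states M) \<Otimes>\<^sub>M traj_space M (Suc h)
        \<rightarrow>\<^sub>M (states M \<Otimes>\<^sub>M count_space (actions M)) \<Otimes>\<^sub>M traj_space M (Suc h)"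
    by (intro measurable_Pair measurable_compose[OF measurable_fst measurable_fst] measurable_snd)
  from measurable_compose[OF measurable_compose[OF this traj_update_measurable[OF h]]
      measurable_return_prob_space]
  have upd: "(\<lambda>(p, \<omega>). return (traj_space M h) (fun_upd \<omega> h (fst p))) \<in>
      ((states M \<Otimes>\<^sub>M count_space (actions M)) \<Otimes>\<^sub>M states M) \<Otimes>\<^sub>M traj_space M (Suc h)
        \<rightarrow>\<^sub>M prob_algebra (traj_space M h)"
    by (simp add: case_prod_unfold)
  show ?tail
    unfolding case_prod_unfold
    by (rule measurable_bind_prob_space2[OF measurable_compose[OF measurable_snd tail] upd])
  from measurable_bind_prob_space2[OF state_action_measurable[OF trans_kernel[OF h]] this]
  show ?trans
    by (simp add: case_prod_unfold)
qed

lemma traj_Suc: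
  "h \<in> {1..horizon M} \<Longrightarrow> traj M \<pi> h s = \<pi> h s \<bind> (\<lambda>a. trans M h s a \<bind> (\<lambda>s'.
    traj M \<pi> (Suc h) s' \<bind> (\<lambda>\<omega>. return (traj_space M h) (fun_upd \<omega> h (s, a)))))"
  by (simp add: traj.simps[of M \<pi> h])

lemma traj_kernel:
  assumes \<pi>: "\<pi> \<in> policies M" and "1 \<le> h"
  shows "traj M \<pi> h \<in> states M \<rightarrow>\<^sub>M prob_algebra (traj_space M h)"
  using \<open>1 \<le> h\<close>
proof (induction h rule: backward_induct)
  case (terminal h)
  then have "traj M \<pi> h = (\<lambda>s. return (traj_space M h) (\<lambda>_. undefined))"
    by (intro ext) (simp add: traj.simps[of M \<pi> h])
  moreover have "(\<lambda>_. undefined) \<in> space (traj_space M h)"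
    using terminal by (simp add: space_PiM)
  ultimately show ?case
    by (simp add: space_prob_algebra prob_space_return)
next
  case (step h)
  have \<pi>h: "\<pi> h \<in> states M \<rightarrow>\<^sub>M prob_algebra (count_space (actions M))"
    using \<pi> step by (auto simp: policies_def)
  have "traj M \<pi> h = (\<lambda>s. \<pi> h s \<bind> (\<lambda>a. trans M h s a \<bind> (\<lambda>s'. traj M \<pi> (Suc h) s' \<bind>
      (\<lambda>\<omega>. return (traj_space M h) (fun_upd \<omega> h (s, a))))))"
    by (intro ext traj_Suc step)
  then show ?case
    using measurable_bind_prob_space2[OF \<pi>h traj_tail_kernel(2)[OF step(1,2)]] by simp
qed

abbreviation total :: "(nat \<Rightarrow> 's \<Rightarrow> 'a \<Rightarrow> real) \<Rightarrow> nat \<Rightarrow> (nat \<Rightarrow> 's \<times> 'a) \<Rightarrow> real" where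
  "total g h \<omega> \<equiv> (\<Sum>t=h..horizon M. g t (fst (\<omega> t)) (snd (\<omega> t)))"

lemma total_measurable:
  assumes "stage_function g" "1 \<le> h"
  shows "total g h \<in> borel_measurable (traj_space M h)"
proof (rule borel_measurable_sum)
  fix t assume t: "t \<in> {h..horizon M}"
  have "(\<lambda>p. g t (fst p) (snd p)) \<in> borel_measurable (states M \<Otimes>\<^sub>M count_space (actions M))"
    using assms t by (intro state_action_measurable) (auto simp: stage_function_def bounded_measurable_def)
  then show "(\<lambda>\<omega>. g t (fst (\<omega> t)) (snd (\<omega> t))) \<in> borel_measurable (traj_space M h)"
    by (rule measurable_compose[OF measurable_component_singleton[OF t]])
qed

lemma total_bounded:
  assumes "stage_function g" "1 \<le> h"
  obtains B where "\<And>\<omega>. \<omega> \<in> space (traj_space M h) \<Longrightarrow> \<bar>total g h \<omega>\<bar> \<le> B"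
proof -
  have "\<exists>C. \<forall>s\<in>space (states M). \<bar>g t s a\<bar> \<le> C" if "t \<in> {h..horizon M}" "a \<in> actions M" for t a
    using assms that by (auto simp: stage_function_def bounded_measurable_def)
  then obtain C where C: "\<And>t a s. t \<in> {h..horizon M} \<Longrightarrow> a \<in> actions M \<Longrightarrow> s \<in> space (states M) \<Longrightarrow>
      \<bar>g t s a\<bar> \<le> C t a"
    by metis
  have "\<bar>total g h \<omega>\<bar> \<le> (\<Sum>t=h..horizon M. \<Sum>a\<in>actions M. \<bar>C t a\<bar>)"
    if \<omega>: "\<omega> \<in> space (traj_space M h)" for \<omega>
  proof (rule order_trans[OF sum_abs sum_mono])
    fix t assume t: "t \<in> {h..horizon M}"
    have "\<omega> \<in> {h..horizon M} \<rightarrow>\<^sub>E space (states M) \<times> actions M"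
      using \<omega> by (simp add: space_PiM space_pair_measure)
    from PiE_mem[OF this t] have sa: "fst (\<omega> t) \<in> space (states M)" "snd (\<omega> t) \<in> actions M"
      by auto
    have "\<bar>g t (fst (\<omega> t)) (snd (\<omega> t))\<bar> \<le> \<bar>C t (snd (\<omega> t))\<bar>"
      using C[OF t sa(2,1)] by simp
    also have "\<dots> \<le> (\<Sum>a\<in>actions M. \<bar>C t a\<bar>)"
      using sa finite_actions by (intro member_le_sum) auto
    finally show "\<bar>g t (fst (\<omega> t)) (snd (\<omega> t))\<bar> \<le> (\<Sum>a\<in>actions M. \<bar>C t a\<bar>)" .
  qed
  then show thesis
    by (rule that)
qed

lemma bounded_measurable_policy_value:
  assumes "\<pi> \<in> policies M" "stage_function g" "1 \<le> h"
  shows "bounded_measurable (policy_value M \<pi> g h)"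
proof -
  obtain B where "\<And>\<omega>. \<omega> \<in> space (traj_space M h) \<Longrightarrow> \<bar>total g h \<omega>\<bar> \<le> B"
    using total_bounded[OF assms(2,3)] by blast
  from bounded_measurable_integral_kernel[OF traj_kernel[OF assms(1,3)] total_measurable[OF assms(2,3)] this]
  show ?thesis
    unfolding policy_value_def .
qed

lemma traj_prob_space:
  assumes "\<pi> \<in> policies M" "1 \<le> h" "s \<in> space (states M)"
  shows "prob_space (traj M \<pi> h s)" "sets (traj M \<pi> h s) = sets (traj_space M h)"
    "space (traj M \<pi> h s) = space (traj_space M h)"
  using measurable_space[OF traj_kernel[OF assms(1,2)] assms(3)]
  by (auto simp: space_prob_algebra dest: sets_eq_imp_space_eq)

lemma integrable_total:
  assumes "\<pi> \<in> policies M" "stage_function g" "1 \<le> h" "s \<in> space (states M)"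
  shows "integrable (traj M \<pi> h s) (total g h)"
proof -
  note T = traj_prob_space[OF assms(1,3,4)]
  interpret P: prob_space "traj M \<pi> h s"
    by (rule T)
  obtain B where "\<And>\<omega>. \<omega> \<in> space (traj_space M h) \<Longrightarrow> \<bar>total g h \<omega>\<bar> \<le> B"
    using total_bounded[OF assms(2,3)] by blast
  then show ?thesis
    using T(3) total_measurable[OF assms(2,3)]
    by (intro P.integrable_const_bound[where B=B] AE_I2)
      (simp_all add: measurable_cong_sets[OF T(2) refl])
qed

lemma policy_value_terminal: "horizon M < h \<Longrightarrow> policy_value M \<pi> g h s = 0"
  by (simp add: policy_value_def)

lemma total_update:
  assumes "h \<in> {1..horizon M}"
  shows "total g h (fun_upd \<omega> h (s, a)) = g h s a + total g (Suc h) \<omega>"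
  using assms by (simp add: sum.atLeast_Suc_atMost)

lemma policy_value_bellman:
  assumes \<pi>: "\<pi> \<in> policies M" and g: "stage_function g" and h: "h \<in> {1..horizon M}"
    and s: "s \<in> space (states M)"
  shows "policy_value M \<pi> g h s = (\<integral>a. backup M g h (policy_value M \<pi> g (Suc h)) s a \<partial>\<pi> h s)"
proof -
  have h1: "1 \<le> h" using h by simp
  obtain B where B: "\<And>\<omega>. \<omega> \<in> space (traj_space M h) \<Longrightarrow> \<bar>total g h \<omega>\<bar> \<le> B"
    using total_bounded[OF g h1] by blast
  note [simp] = total_measurable[OF g h1]
  have tail: "traj M \<pi> (Suc h) \<in> states M \<rightarrow>\<^sub>M prob_algebra (traj_space M (Suc h))"
    by (rule traj_kernel[OF \<pi>]) simp
  define K3 where "K3 a s' = traj M \<pi> (Suc h) s' \<bind>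
    (\<lambda>\<omega>. return (traj_space M h) (fun_upd \<omega> h (s, a)))" for a s'
  define K2 where "K2 a = trans M h s a \<bind> K3 a" for a
  have "K2 \<in> count_space (actions M) \<rightarrow>\<^sub>M prob_algebra (traj_space M h)"
    using measurable_compose[OF measurable_Pair1'[OF s] traj_tail_kernel(2)[OF h tail]]
    by (simp add: K2_def[abs_def] K3_def[abs_def])
  then have K2: "K2 \<in> \<pi> h s \<rightarrow>\<^sub>M prob_algebra (traj_space M h)"
    using policy_space(2)[OF \<pi> h s]
      measurable_cong_sets[of "\<pi> h s" "count_space (actions M)" "prob_algebra (traj_space M h)"]
    by simp
  have K3_int: "(\<integral>\<omega>. total g h \<omega> \<partial>K3 a s') = g h s a + policy_value M \<pi> g (Suc h) s'"
    if a: "a \<in> actions M" and s': "s' \<in> space (states M)" for a s'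
  proof -
    have p: "(s, a) \<in> space (states M \<Otimes>\<^sub>M count_space (actions M))"
      using s a by (simp add: space_pair_measure)
    note T = traj_prob_space[OF \<pi> _ s', of "Suc h", simplified]
    interpret P: prob_space "traj M \<pi> (Suc h) s'"
      by (rule T)
    have upd: "(\<lambda>\<omega>. fun_upd \<omega> h (s, a)) \<in> traj_space M (Suc h) \<rightarrow>\<^sub>M traj_space M h"
      using measurable_compose[OF measurable_Pair1'[OF p] traj_update_measurable[OF h]] by simp
    have "(\<lambda>\<omega>. return (traj_space M h) (fun_upd \<omega> h (s, a))) \<in>
        traj M \<pi> (Suc h) s' \<rightarrow>\<^sub>M prob_algebra (traj_space M h)"
      using measurable_compose[OF upd measurable_return_prob_space]
      by (simp add: measurable_cong_sets[OF T(2) refl])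
    from integral_bind_prob[OF total_measurable[OF g h1] B this P.prob_space_axioms]
    have "(\<integral>\<omega>. total g h \<omega> \<partial>K3 a s') =
        (\<integral>\<omega>. \<integral>\<omega>'. total g h \<omega>' \<partial>return (traj_space M h) (fun_upd \<omega> h (s, a)) \<partial>traj M \<pi> (Suc h) s')"
      by (simp add: K3_def)
    also have "\<dots> = (\<integral>\<omega>. g h s a + total g (Suc h) \<omega> \<partial>traj M \<pi> (Suc h) s')"
    proof (rule Bochner_Integration.integral_cong[OF refl])
      fix \<omega> assume "\<omega> \<in> space (traj M \<pi> (Suc h) s')"
      then have "fun_upd \<omega> h (s, a) \<in> space (traj_space M h)"
        using measurable_space[OF upd] T(3) by simp
      from integral_return[OF this total_measurable[OF g h1]]
      show "(\<integral>\<omega>'. total g h \<omega>' \<partial>return (traj_space M h) (fun_upd \<omega> h (s, a))) =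
          g h s a + total g (Suc h) \<omega>"
        using total_update[OF h] by simp
    qed
    also have "\<dots> = g h s a + policy_value M \<pi> g (Suc h) s'"
      using integrable_total[OF \<pi> g _ s', of "Suc h"]
      by (simp add: policy_value_def P.prob_space)
    finally show ?thesis .
  qed
  have K2_int: "(\<integral>\<omega>. total g h \<omega> \<partial>K2 a) = backup M g h (policy_value M \<pi> g (Suc h)) s a"
    if a: "a \<in> actions M" for a
  proof -
    note T = trans_space[OF h a s]
    interpret P: prob_space "trans M h s a"
      by (rule T)
    have p: "(s, a) \<in> space (states M \<Otimes>\<^sub>M count_space (actions M))"
      using s a by (simp add: space_pair_measure)
    have "K3 a \<in> trans M h s a \<rightarrow>\<^sub>M prob_algebra (traj_space M h)"
      using measurable_compose[OF measurable_Pair1'[OF p] traj_tail_kernel(1)[OF h tail]]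
      by (simp add: K3_def[abs_def] measurable_cong_sets[OF T(2) refl])
    from integral_bind_prob[OF total_measurable[OF g h1] B this P.prob_space_axioms]
    have "(\<integral>\<omega>. total g h \<omega> \<partial>K2 a) = (\<integral>s'. \<integral>\<omega>. total g h \<omega> \<partial>K3 a s' \<partial>trans M h s a)"
      by (simp add: K2_def)
    also have "\<dots> = (\<integral>s'. g h s a + policy_value M \<pi> g (Suc h) s' \<partial>trans M h s a)"
      using K3_int[OF a] T(3) by (intro Bochner_Integration.integral_cong) simp_all
    also have "\<dots> = backup M g h (policy_value M \<pi> g (Suc h)) s a"
      using integrable_trans[OF h a s bounded_measurable_policy_value[OF \<pi> g, of "Suc h"]]
      by (simp add: backup_def P.prob_space)
    finally show ?thesis .
  qed
  have "policy_value M \<pi> g h s = (\<integral>\<omega>. total g h \<omega> \<partial>(\<pi> h s \<bind> K2))"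
    by (simp add: policy_value_def traj_Suc[OF h] K2_def[abs_def] K3_def[abs_def])
  also have "\<dots> = (\<integral>a. \<integral>\<omega>. total g h \<omega> \<partial>K2 a \<partial>\<pi> h s)"
    by (rule integral_bind_prob[OF total_measurable[OF g h1] B K2 policy_space(1)[OF \<pi> h s]])
  also have "\<dots> = (\<integral>a. backup M g h (policy_value M \<pi> g (Suc h)) s a \<partial>\<pi> h s)"
    using K2_int policy_space(3)[OF \<pi> h s] by (intro Bochner_Integration.integral_cong) simp_all
  finally show ?thesis .
qed

lemma opt_value_terminal: "horizon M < h \<Longrightarrow> opt_value M g h s = 0"
  by (simp add: opt_value.simps)

lemma opt_value_step:
  "h \<in> {1..horizon M} \<Longrightarrow>
    opt_value M g h s = Max (backup M g h (opt_value M g (Suc h)) s ` actions M)"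
  by (simp add: opt_value.simps[of M g h])

lemma backup_le_opt_value:
  assumes "h \<in> {1..horizon M}" "a \<in> actions M"
  shows "backup M g h (opt_value M g (Suc h)) s a \<le> opt_value M g h s"
  using assms finite_actions by (simp add: opt_value_step)

lemma opt_value_attained:
  assumes "h \<in> {1..horizon M}"
  obtains a where "a \<in> actions M" "opt_value M g h s = backup M g h (opt_value M g (Suc h)) s a"
proof -
  have "opt_value M g h s \<in> backup M g h (opt_value M g (Suc h)) s ` actions M"
    unfolding opt_value_step[OF assms]
    using finite_actions actions_nonempty by (intro Max_in) auto
  then show thesis
    using that by blast
qed

lemma opt_value_leI:
  assumes "h \<in> {1..horizon M}"
    and "\<And>a. a \<in> actions M \<Longrightarrow> backup M g h (opt_value M g (Suc h)) s a \<le> c"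
  shows "opt_value M g h s \<le> c"
  using opt_value_attained[OF assms(1), of g s] assms(2) by metis

lemma bounded_measurable_opt_value:
  assumes g: "stage_function g" and "1 \<le> h"
  shows "bounded_measurable (opt_value M g h)"
  using \<open>1 \<le> h\<close>
proof (induction h rule: backward_induct)
  case (terminal h)
  then have "opt_value M g h = (\<lambda>_. 0)"
    by (intro ext opt_value_terminal)
  then show ?case
    by (auto simp: bounded_measurable_def)
next
  case (step h)
  let ?q = "backup M g h (opt_value M g (Suc h))"
  have q: "bounded_measurable (\<lambda>s. ?q s a)" if "a \<in> actions M" for a
    by (rule bounded_measurable_backup[OF g step(1) that step(2)])
  have "opt_value M g h = (\<lambda>s. Max ((\<lambda>a. ?q s a) ` actions M))"
    by (intro ext opt_value_step[OF step(1)])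
  moreover have "(\<lambda>s. Max ((\<lambda>a. ?q s a) ` actions M)) \<in> borel_measurable (states M)"
    using q finite_actions by (intro borel_measurable_Max) (auto simp: bounded_measurable_def)
  moreover obtain C where C: "\<And>a s. a \<in> actions M \<Longrightarrow> s \<in> space (states M) \<Longrightarrow> \<bar>?q s a\<bar> \<le> C a"
    using q unfolding bounded_measurable_def by metis
  have "\<bar>opt_value M g h s\<bar> \<le> (\<Sum>a\<in>actions M. \<bar>C a\<bar>)" if s: "s \<in> space (states M)" for s
  proof -
    obtain a where a: "a \<in> actions M" "opt_value M g h s = ?q s a"
      using opt_value_attained[OF step(1)] .
    then have "\<bar>opt_value M g h s\<bar> \<le> \<bar>C a\<bar>"
      using C[OF a(1) s] by simp
    also have "\<dots> \<le> (\<Sum>a\<in>actions M. \<bar>C a\<bar>)"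
      using a finite_actions by (intro member_le_sum) auto
    finally show ?thesis .
  qed
  ultimately show ?case
    by (auto simp: bounded_measurable_def)
qed

lemma backup_mono:
  assumes "h \<in> {1..horizon M}" "a \<in> actions M" "s \<in> space (states M)"
    and "bounded_measurable f" "bounded_measurable f'"
    and "\<And>s'. s' \<in> space (states M) \<Longrightarrow> f s' \<le> f' s'"
  shows "backup M g h f s a \<le> backup M g h f' s a"
  unfolding backup_def
  using assms trans_space(3)[OF assms(1-3)]
  by (intro add_left_mono integral_mono_AE integrable_trans AE_I2) auto

lemma policy_value_le_opt_value:
  assumes \<pi>: "\<pi> \<in> policies M" and g: "stage_function g" and "1 \<le> h" "s \<in> space (states M)"
  shows "policy_value M \<pi> g h s \<le> opt_value M g h s"
  using \<open>1 \<le> h\<close> \<open>s \<in> space (states M)\<close>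
proof (induction h arbitrary: s rule: backward_induct)
  case (terminal h)
  then show ?case
    by (simp add: policy_value_terminal opt_value_terminal)
next
  case (step h)
  interpret P: prob_space "\<pi> h s"
    using \<pi> step by (intro policy_space) auto
  have "backup M g h (policy_value M \<pi> g (Suc h)) s a \<le> opt_value M g h s" if a: "a \<in> actions M" for a
  proof -
    have "backup M g h (policy_value M \<pi> g (Suc h)) s a \<le> backup M g h (opt_value M g (Suc h)) s a"
      using step a bounded_measurable_policy_value[OF \<pi> g] bounded_measurable_opt_value[OF g]
      by (intro backup_mono) auto
    also have "\<dots> \<le> opt_value M g h s"
      by (rule backup_le_opt_value[OF step(1) a])
    finally show ?thesis .
  qed
  then show ?case
    unfolding policy_value_bellman[OF \<pi> g step(1,3)]
    using policy_space(3)[OF \<pi> step(1,3)] integrable_policy[OF \<pi> step(1,3)]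
    by (intro P.integral_le_const AE_I2) auto
qed

definition det_policy :: "(nat \<Rightarrow> 's \<Rightarrow> 'a) \<Rightarrow> nat \<Rightarrow> 's \<Rightarrow> 'a measure" where
  "det_policy f h s = return (count_space (actions M)) (f h s)"

definition decision_rule :: "(nat \<Rightarrow> 's \<Rightarrow> 'a) \<Rightarrow> bool" where
  "decision_rule f \<longleftrightarrow> (\<forall>h\<in>{1..horizon M}. f h \<in> states M \<rightarrow>\<^sub>M count_space (actions M))"

lemma det_policy_in_policies:
  assumes "decision_rule f"
  shows "det_policy f \<in> policies M"
proof -
  have "det_policy f h = (\<lambda>s. return (count_space (actions M)) (f h s))" for h
    by (rule ext) (rule det_policy_def)
  then show ?thesis
    using assms measurable_compose[OF _ measurable_return_prob_space]
    by (auto simp: policies_def decision_rule_def)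
qed

lemma decision_rule_in_actions:
  assumes "decision_rule f" "h \<in> {1..horizon M}" "s \<in> space (states M)"
  shows "f h s \<in> actions M"
  using assms measurable_space[of "f h" "states M" "count_space (actions M)" s]
  by (auto simp: decision_rule_def)

lemma policy_value_det_policy:
  assumes f: "decision_rule f" and g: "stage_function g" and h: "h \<in> {1..horizon M}"
    and s: "s \<in> space (states M)"
  shows "policy_value M (det_policy f) g h s =
    backup M g h (policy_value M (det_policy f) g (Suc h)) s (f h s)"
  unfolding policy_value_bellman[OF det_policy_in_policies[OF f] g h s]
  using decision_rule_in_actions[OF f h s]
  by (simp add: det_policy_def integral_return)

definition greedy :: "(nat \<Rightarrow> 's \<Rightarrow> 'a \<Rightarrow> real) \<Rightarrow> (nat \<Rightarrow> 's \<Rightarrow> 'a) \<Rightarrow> bool" where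
  "greedy g f \<longleftrightarrow> decision_rule f \<and> (\<forall>h\<in>{1..horizon M}. \<forall>s\<in>space (states M).
     backup M g h (opt_value M g (Suc h)) s (f h s) = opt_value M g h s)"

lemma greedy_exists:
  assumes g: "stage_function g"
  shows "\<exists>f. greedy g f"
proof -
  have "\<exists>f. f \<in> states M \<rightarrow>\<^sub>M count_space (actions M) \<and> (\<forall>s\<in>space (states M).
      backup M g h (opt_value M g (Suc h)) s (f s) = opt_value M g h s)"
    if h: "h \<in> {1..horizon M}" for h
  proof -
    let ?P = "\<lambda>s a. backup M g h (opt_value M g (Suc h)) s a = opt_value M g h s"
    have "Measurable.pred (states M) (\<lambda>s. ?P s a)" if "a \<in> actions M" for a
    proof -
      have [measurable]: "(\<lambda>s. backup M g h (opt_value M g (Suc h)) s a) \<in> borel_measurable (states M)"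
        "opt_value M g h \<in> borel_measurable (states M)"
        using bounded_measurable_backup[OF g h that bounded_measurable_opt_value[OF g]]
          bounded_measurable_opt_value[OF g, of h] h
        by (auto simp: bounded_measurable_def)
      show ?thesis by measurable
    qed
    moreover have "\<exists>a\<in>actions M. ?P s a" for s
      using opt_value_attained[OF h, of g s] by metis
    ultimately obtain f where "f \<in> states M \<rightarrow>\<^sub>M count_space (actions M)"
        "\<And>s. s \<in> space (states M) \<Longrightarrow> ?P s (f s)"
      using measurable_finite_selection[OF finite_actions, where N="states M" and P="?P"] by blast
    then show ?thesis by blast
  qed
  then show ?thesis
    unfolding greedy_def decision_rule_def by metis
qed

lemma policy_value_greedy:
  assumes g: "stage_function g" and f: "greedy g f" and "1 \<le> h" "s \<in> space (states M)"
  shows "policy_value M (det_policy f) g h s = opt_value M g h s"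
  using \<open>1 \<le> h\<close> \<open>s \<in> space (states M)\<close>
proof (induction h arbitrary: s rule: backward_induct)
  case (terminal h)
  then show ?case
    by (simp add: policy_value_terminal opt_value_terminal)
next
  case (step h)
  have dr: "decision_rule f"
    using f by (simp add: greedy_def)
  have "backup M g h (policy_value M (det_policy f) g (Suc h)) s (f h s) =
      backup M g h (opt_value M g (Suc h)) s (f h s)"
    unfolding backup_def
    using step trans_space(3)[OF step(1) decision_rule_in_actions[OF dr step(1,3)] step(3)]
    by (auto intro!: Bochner_Integration.integral_cong)
  also have "\<dots> = opt_value M g h s"
    using f step by (auto simp: greedy_def)
  finally show ?case
    using policy_value_det_policy[OF dr g step(1,3)] by simp
qed

lemma opt_value_le:
  assumes g: "stage_function g"
    and b: "\<And>h s a. h \<in> {1..horizon M} \<Longrightarrow> s \<in> space (states M) \<Longrightarrow> a \<in> actions M \<Longrightarrow> g h s a \<le> b"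
    and "1 \<le> h" "s \<in> space (states M)"
  shows "opt_value M g h s \<le> b * real (Suc (horizon M) - h)"
  using \<open>1 \<le> h\<close> \<open>s \<in> space (states M)\<close>
proof (induction h arbitrary: s rule: backward_induct)
  case (terminal h)
  then show ?case
    by (simp add: opt_value_terminal)
next
  case (step h)
  show ?case
  proof (rule opt_value_leI[OF step(1)])
    fix a assume a: "a \<in> actions M"
    note T = trans_space[OF step(1) a step(3)]
    interpret P: prob_space "trans M h s a"
      by (rule T)
    have "(\<integral>s'. opt_value M g (Suc h) s' \<partial>trans M h s a) \<le> b * real (Suc (horizon M) - Suc h)"
      using step(2) T(3) integrable_trans[OF step(1) a step(3) bounded_measurable_opt_value[OF g]]
      by (intro P.integral_le_const AE_I2) auto
    moreover have "real (Suc (horizon M) - h) = 1 + real (Suc (horizon M) - Suc h)"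
      using step(1) by auto
    ultimately show "backup M g h (opt_value M g (Suc h)) s a \<le> b * real (Suc (horizon M) - h)"
      using b[OF step(1,3) a] by (simp add: backup_def distrib_left)
  qed
qed

lemma stage_function_reward: "stage_function (reward M)"
  unfolding stage_function_def bounded_measurable_def
proof (intro ballI conjI exI)
  fix h a s assume "h \<in> {1..horizon M}" "a \<in> actions M" "s \<in> space (states M)"
  then show "\<bar>reward M h s a\<bar> \<le> 1"
    using reward_range[of h s a] by simp
qed (rule reward_measurable)

lemma stage_function_cost: "stage_function (cost M)"
  using reset_measurable
  by (auto simp: stage_function_def bounded_measurable_def cost_def indicator_def
      intro!: exI[of _ 1])

lemma stage_function_diff:
  assumes "stage_function g" "stage_function g'"
  shows "stage_function (\<lambda>h s a. g h s a - y * g' h s a)"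
  using assms bounded_measurable_add[OF _ bounded_measurable_cmult[of _ "- y"]]
  by (simp add: stage_function_def)

lemma policy_value_diff:
  assumes "\<pi> \<in> policies M" "stage_function g" "stage_function g'" "1 \<le> h" "s \<in> space (states M)"
  shows "policy_value M \<pi> (\<lambda>h s a. g h s a - y * g' h s a) h s =
    policy_value M \<pi> g h s - y * policy_value M \<pi> g' h s"
  using integrable_total[OF assms(1,2,4,5)] integrable_total[OF assms(1,3,4,5)]
  by (simp add: policy_value_def sum_subtractf flip: sum_distrib_left)

abbreviation lag :: "real \<Rightarrow> nat \<Rightarrow> 's \<Rightarrow> 'a \<Rightarrow> real" where
  "lag y \<equiv> (\<lambda>h s a. reward M h s a - y * cost M h s a)"

abbreviation neg_cost :: "nat \<Rightarrow> 's \<Rightarrow> 'a \<Rightarrow> real" where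
  "neg_cost \<equiv> (\<lambda>h s a. - cost M h s a)"

lemma stage_function_lag: "stage_function (lag y)"
  by (intro stage_function_diff stage_function_reward stage_function_cost)

lemma stage_function_neg_cost: "stage_function neg_cost"
  using stage_function_cost bounded_measurable_cmult[of _ "- 1"] by (simp add: stage_function_def)

lemma lagrangian_eq:
  assumes "\<pi> \<in> policies M" "s \<in> space (states M)"
  shows "lagrangian M s \<pi> y = policy_value M \<pi> (lag y) 1 s"
  using policy_value_diff[OF assms(1) stage_function_reward stage_function_cost _ assms(2), of 1 y]
  by (simp add: lagrangian_def)

lemma lagrangian_le_opt_value:
  assumes "\<pi> \<in> policies M" "s \<in> space (states M)"
  shows "lagrangian M s \<pi> y \<le> opt_value M (lag y) 1 s"
  unfolding lagrangian_eq[OF assms]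
  by (intro policy_value_le_opt_value stage_function_lag assms) simp

lemma lagrangian_attains_opt_value:
  "\<exists>\<pi>\<in>policies M. \<forall>s\<in>space (states M). lagrangian M s \<pi> y = opt_value M (lag y) 1 s"
proof -
  obtain f where f: "greedy (lag y) f"
    using greedy_exists[OF stage_function_lag] by blast
  then have \<pi>: "det_policy f \<in> policies M"
    by (intro det_policy_in_policies) (simp add: greedy_def)
  then show ?thesis
    using policy_value_greedy[OF stage_function_lag f, of 1] by (intro bexI[OF _ \<pi>]) (simp add: lagrangian_eq)
qed

lemma dual_fun_eq:
  assumes s: "s \<in> space (states M)"
  shows "dual_fun M s y = opt_value M (lag y) 1 s"
proof -
  obtain \<pi> where \<pi>: "\<pi> \<in> policies M" "lagrangian M s \<pi> y = opt_value M (lag y) 1 s"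
    using lagrangian_attains_opt_value[of y] s by blast
  show ?thesis
    unfolding dual_fun_def
    using \<pi> lagrangian_le_opt_value[OF _ s] by (intro cSup_eq_maximum) (auto intro!: image_eqI[of _ _ \<pi>])
qed

abbreviation safe :: "nat \<Rightarrow> 's \<Rightarrow> bool" where
  "safe h s \<equiv> opt_value M neg_cost h s = 0"

abbreviation safety :: "nat \<Rightarrow> 's \<Rightarrow> 'a \<Rightarrow> real" where
  "safety h \<equiv> backup M neg_cost h (opt_value M neg_cost (Suc h))"

lemma opt_neg_cost_nonpos:
  assumes "1 \<le> h" "s \<in> space (states M)"
  shows "opt_value M neg_cost h s \<le> 0"
  using opt_value_le[OF stage_function_neg_cost _ assms, of 0] by (simp add: cost_def)

lemma safety_nonpos:
  assumes "h \<in> {1..horizon M}" "a \<in> actions M" "s \<in> space (states M)"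
  shows "safety h s a \<le> 0"
  using backup_le_opt_value[OF assms(1,2), of neg_cost s] opt_neg_cost_nonpos[of h s] assms by auto

lemma feasible_imp_safe:
  assumes s: "s \<in> space (states M)" and "feasible M s"
  shows "safe 1 s"
proof -
  obtain \<pi> where \<pi>: "\<pi> \<in> policies M" "policy_value M \<pi> (cost M) 1 s \<le> 0"
    using assms by (auto simp: feasible_def)
  have "policy_value M \<pi> neg_cost 1 s = - policy_value M \<pi> (cost M) 1 s"
    by (simp add: policy_value_def sum_negf)
  then show ?thesis
    using policy_value_le_opt_value[OF \<pi>(1) stage_function_neg_cost _ s, of 1] \<pi>(2)
      opt_neg_cost_nonpos[OF _ s, of 1] by simp
qed

lemma safe_action:
  assumes "h \<in> {1..horizon M}" "a \<in> actions M" "s \<in> space (states M)" and q: "safety h s a = 0"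
  shows "cost M h s a = 0" "AE s' in trans M h s a. safe (Suc h) s'"
proof -
  note T = trans_space[OF assms(1-3)]
  let ?C = "opt_value M neg_cost (Suc h)"
  have int: "integrable (trans M h s a) (\<lambda>s'. - ?C s')"
    using integrable_trans[OF assms(1-3) bounded_measurable_opt_value[OF stage_function_neg_cost]] by simp
  have nonneg: "AE s' in trans M h s a. 0 \<le> - ?C s'"
    using opt_neg_cost_nonpos[of "Suc h"] T(3) by (intro AE_I2) simp
  have "0 \<le> (\<integral>s'. - ?C s' \<partial>trans M h s a)"
    using nonneg by (rule integral_nonneg_AE)
  moreover have "cost M h s a \<ge> 0"
    by (simp add: cost_def)
  ultimately have "cost M h s a = 0" and "(\<integral>s'. - ?C s' \<partial>trans M h s a) = 0"
    using q by (simp_all add: backup_def)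
  then show "cost M h s a = 0" "AE s' in trans M h s a. safe (Suc h) s'"
    using integral_nonneg_eq_0_iff_AE[OF int nonneg] by simp_all
qed

text \<open>The penalty exceeds every total reward, so an optimal policy for the penalised
  reward never leaves the safe states.\<close>

definition penalised :: "nat \<Rightarrow> 's \<Rightarrow> 'a \<Rightarrow> real" where
  "penalised h s a = reward M h s a - (if safety h s a < 0 then real (horizon M) + 1 else 0)"

lemma stage_function_penalised: "stage_function penalised"
  unfolding stage_function_def
proof (intro ballI)
  fix h a assume h: "h \<in> {1..horizon M}" and a: "a \<in> actions M"
  have [measurable]: "(\<lambda>s. safety h s a) \<in> borel_measurable (states M)"
    using bounded_measurable_backup[OF stage_function_neg_cost h a
        bounded_measurable_opt_value[OF stage_function_neg_cost]]
    by (simp add: bounded_measurable_def)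
  have "bounded_measurable (\<lambda>s. - (if safety h s a < 0 then real (horizon M) + 1 else 0))"
    unfolding bounded_measurable_def
    by (intro conjI exI[of _ "real (horizon M) + 1"]) auto
  moreover have "bounded_measurable (\<lambda>s. reward M h s a)"
    using stage_function_reward h a by (simp add: stage_function_def)
  ultimately show "bounded_measurable (\<lambda>s. penalised h s a)"
    unfolding penalised_def using bounded_measurable_add by fastforce
qed

abbreviation safe_value :: "nat \<Rightarrow> 's \<Rightarrow> real" where
  "safe_value \<equiv> opt_value M penalised"

lemma bounded_measurable_safe_value: "1 \<le> h \<Longrightarrow> bounded_measurable (safe_value h)"
  by (rule bounded_measurable_opt_value[OF stage_function_penalised])

lemma penalised_safe: "safety h s a = 0 \<Longrightarrow> penalised h s a = reward M h s a"
  by (simp add: penalised_def)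

lemma safe_value_nonneg:
  assumes "1 \<le> h" "s \<in> space (states M)" "safe h s"
  shows "0 \<le> safe_value h s"
  using assms
proof (induction h arbitrary: s rule: backward_induct)
  case (terminal h)
  then show ?case
    by (simp add: opt_value_terminal)
next
  case (step h)
  obtain a where a: "a \<in> actions M" "safety h s a = 0"
    using opt_value_attained[OF step(1), of neg_cost s] step.prems(2) by metis
  note S = safe_action[OF step(1) a(1) step.prems(1) a(2)]
  have "AE s' in trans M h s a. 0 \<le> safe_value (Suc h) s'"
    using S(2) AE_space
  proof eventually_elim
    case (elim s')
    then show ?case
      using step(2)[of s'] trans_space(3)[OF step(1) a(1) step.prems(1)] by simp
  qed
  then have "0 \<le> backup M penalised h (safe_value (Suc h)) s a"
    using reward_range[OF step(1) step.prems(1) a(1)]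
    by (simp add: backup_def penalised_safe[OF a(2)] integral_nonneg_AE)
  also have "\<dots> \<le> safe_value h s"
    by (rule backup_le_opt_value[OF step(1) a(1)])
  finally show ?case .
qed

lemma greedy_penalised_safe:
  assumes f: "greedy penalised f" and h: "h \<in> {1..horizon M}" and s: "s \<in> space (states M)"
    and "safe h s"
  shows "safety h s (f h s) = 0"
proof (rule ccontr)
  assume "safety h s (f h s) \<noteq> 0"
  have dr: "decision_rule f"
    using f by (simp add: greedy_def)
  note a = decision_rule_in_actions[OF dr h s]
  have q: "safety h s (f h s) < 0"
    using \<open>safety h s (f h s) \<noteq> 0\<close> safety_nonpos[OF h a s] by simp
  note T = trans_space[OF h a s]
  interpret P: prob_space "trans M h s (f h s)"
    by (rule T)
  have "safe_value (Suc h) s' \<le> real (horizon M - h)" if "s' \<in> space (states M)" for s'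
  proof -
    have "penalised h s a \<le> 1" if "h \<in> {1..horizon M}" "s \<in> space (states M)" "a \<in> actions M" for h s a
      using reward_range[OF that] by (simp add: penalised_def)
    from opt_value_le[OF stage_function_penalised this _ that, of "Suc h"] show ?thesis
      by simp
  qed
  then have "(\<integral>s'. safe_value (Suc h) s' \<partial>trans M h s (f h s)) \<le> real (horizon M - h)"
    using T(3) integrable_trans[OF h a s bounded_measurable_safe_value]
    by (intro P.integral_le_const AE_I2) auto
  moreover have "reward M h s (f h s) \<le> 1"
    using reward_range[OF h s a] by simp
  moreover have "real (horizon M - h) \<le> real (horizon M) - 1"
    using h by auto
  ultimately have "backup M penalised h (safe_value (Suc h)) s (f h s) < 0"
    using q by (simp add: backup_def penalised_def)
  moreover have "backup M penalised h (safe_value (Suc h)) s (f h s) = safe_value h s"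
    using f h s by (simp add: greedy_def)
  ultimately show False
    using safe_value_nonneg[of h s] assms by simp
qed

lemma greedy_penalised_values:
  assumes f: "greedy penalised f" and "1 \<le> h" "s \<in> space (states M)" "safe h s"
  shows "policy_value M (det_policy f) (cost M) h s = 0 \<and>
    policy_value M (det_policy f) (reward M) h s = safe_value h s"
  using assms(2-)
proof (induction h arbitrary: s rule: backward_induct)
  case (terminal h)
  then show ?case
    by (simp add: policy_value_terminal opt_value_terminal)
next
  case (step h)
  have dr: "decision_rule f"
    using f by (simp add: greedy_def)
  note a = decision_rule_in_actions[OF dr step(1) step.prems(1)]
  note q = greedy_penalised_safe[OF f step(1) step.prems]
  note S = safe_action[OF step(1) a step.prems(1) q]
  note \<pi> = det_policy_in_policies[OF dr]
  note integ = integrable_trans[OF step(1) a step.prems(1), THEN borel_measurable_integrable]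
  have ae: "AE s' in trans M h s (f h s). policy_value M (det_policy f) (cost M) (Suc h) s' = 0 \<and>
      policy_value M (det_policy f) (reward M) (Suc h) s' = safe_value (Suc h) s'"
    using S(2) AE_space
  proof eventually_elim
    case (elim s')
    then show ?case
      using step(2)[of s'] trans_space(3)[OF step(1) a step.prems(1)] by simp
  qed
  have "(\<integral>s'. policy_value M (det_policy f) (cost M) (Suc h) s' \<partial>trans M h s (f h s)) =
      (\<integral>s'. 0 \<partial>trans M h s (f h s))"
    using ae by (intro integral_cong_AE integ bounded_measurable_policy_value \<pi> stage_function_cost)
      (auto simp: bounded_measurable_def)
  moreover have "(\<integral>s'. policy_value M (det_policy f) (reward M) (Suc h) s' \<partial>trans M h s (f h s)) =
      (\<integral>s'. safe_value (Suc h) s' \<partial>trans M h s (f h s))"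
    using ae by (intro integral_cong_AE integ bounded_measurable_policy_value \<pi> stage_function_reward
        bounded_measurable_safe_value) auto
  moreover have "backup M penalised h (safe_value (Suc h)) s (f h s) = safe_value h s"
    using f step(1) step.prems(1) by (simp add: greedy_def)
  ultimately show ?case
    using S(1) penalised_safe[OF q]
    by (simp add: policy_value_det_policy[OF dr _ step(1) step.prems(1)] stage_function_cost
        stage_function_reward backup_def)
qed

lemma safe_value_le_opt_lag:
  assumes "1 \<le> h" "s \<in> space (states M)" "safe h s"
  shows "safe_value h s \<le> opt_value M (lag y) h s"
proof -
  obtain f where f: "greedy penalised f"
    using greedy_exists[OF stage_function_penalised] by blast
  then have \<pi>: "det_policy f \<in> policies M"
    by (intro det_policy_in_policies) (simp add: greedy_def)
  show ?thesis
    using policy_value_le_opt_value[OF \<pi> stage_function_lag assms(1,2), of y]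
      policy_value_diff[OF \<pi> stage_function_reward stage_function_cost assms(1,2), of y]
      greedy_penalised_values[OF f assms] by simp
qed

lemma backup_lag_le:
  assumes "0 \<le> y" and h: "h \<in> {1..horizon M}" and a: "a \<in> actions M" and s: "s \<in> space (states M)"
    and bound: "\<And>s'. s' \<in> space (states M) \<Longrightarrow>
      opt_value M (lag y) (Suc h) s' \<le> real (horizon M - h) + y * opt_value M neg_cost (Suc h) s'"
  shows "backup M (lag y) h (opt_value M (lag y) (Suc h)) s a \<le> real (Suc (horizon M) - h) + y * safety h s a"
proof -
  note T = trans_space[OF h a s]
  interpret P: prob_space "trans M h s a"
    by (rule T)
  have int: "integrable (trans M h s a) (opt_value M (lag y) (Suc h))"
    "integrable (trans M h s a) (opt_value M neg_cost (Suc h))"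
    by (intro integrable_trans h a s bounded_measurable_opt_value stage_function_lag
        stage_function_neg_cost; simp)+
  have "(\<integral>s'. opt_value M (lag y) (Suc h) s' \<partial>trans M h s a) \<le>
      (\<integral>s'. real (horizon M - h) + y * opt_value M neg_cost (Suc h) s' \<partial>trans M h s a)"
    using bound T(3) int by (intro integral_mono_AE AE_I2) auto
  also have "\<dots> = real (horizon M - h) + y * (\<integral>s'. opt_value M neg_cost (Suc h) s' \<partial>trans M h s a)"
    using int by (simp add: P.prob_space)
  finally show ?thesis
    using reward_range[OF h s a] h
    by (simp add: backup_def algebra_simps Suc_diff_le)
qed

lemma opt_lag_le:
  assumes "0 \<le> y" "1 \<le> h" "s \<in> space (states M)"
  shows "opt_value M (lag y) h s \<le> real (Suc (horizon M) - h) + y * opt_value M neg_cost h s"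
  using assms(2,3)
proof (induction h arbitrary: s rule: backward_induct)
  case (terminal h)
  then show ?case
    by (simp add: opt_value_terminal)
next
  case (step h)
  show ?case
  proof (rule opt_value_leI[OF step(1)])
    fix a assume a: "a \<in> actions M"
    have "backup M (lag y) h (opt_value M (lag y) (Suc h)) s a \<le> real (Suc (horizon M) - h) + y * safety h s a"
      using step(2) by (intro backup_lag_le assms(1) step a) simp
    also have "\<dots> \<le> real (Suc (horizon M) - h) + y * opt_value M neg_cost h s"
      using backup_le_opt_value[OF step(1) a, of neg_cost s] assms(1) by (simp add: mult_left_mono)
    finally show "backup M (lag y) h (opt_value M (lag y) (Suc h)) s a \<le>
        real (Suc (horizon M) - h) + y * opt_value M neg_cost h s" .
  qed
qed

lemma eventually_opt_lag_le_step:
  assumes h: "h \<in> {1..horizon M}" and s: "s \<in> space (states M)" and safe: "safe h s" and "0 \<le> \<epsilon>"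
    and next_le: "\<And>a. a \<in> actions M \<Longrightarrow> safety h s a = 0 \<Longrightarrow>
      \<forall>\<^sub>F n in sequentially. (\<integral>s'. opt_value M (lag (real n)) (Suc h) s' \<partial>trans M h s a) \<le>
        (\<integral>s'. safe_value (Suc h) s' \<partial>trans M h s a) + \<epsilon>"
  shows "\<forall>\<^sub>F n in sequentially. opt_value M (lag (real n)) h s \<le> safe_value h s + \<epsilon>"
proof -
  let ?Q = "\<lambda>n. backup M (lag (real n)) h (opt_value M (lag (real n)) (Suc h)) s"
  have "\<forall>\<^sub>F n in sequentially. ?Q n a \<le> safe_value h s + \<epsilon>" if a: "a \<in> actions M" for a
  proof (cases "safety h s a = 0")
    case True
    have "backup M penalised h (safe_value (Suc h)) s a \<le> safe_value h s"
      by (rule backup_le_opt_value[OF h a])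
    then show ?thesis
      using next_le[OF a True] safe_action(1)[OF h a s True]
      by (auto elim!: eventually_mono simp: backup_def penalised_safe[OF True])
  next
    case False
    then have q: "safety h s a < 0"
      using safety_nonpos[OF h a s] by simp
    let ?N = "real (Suc (horizon M) - h)"
    obtain n0 :: nat where "?N / (- safety h s a) \<le> real n0"
      using real_arch_simple by blast
    then have n0: "?N + real n0 * safety h s a \<le> 0"
      using q by (simp add: field_simps)
    show ?thesis
      using eventually_ge_at_top[of n0]
    proof eventually_elim
      case (elim n)
      have "?Q n a \<le> ?N + real n * safety h s a"
        using opt_lag_le[of "real n" "Suc h"] by (intro backup_lag_le h a s) simp_all
      also have "\<dots> \<le> ?N + real n0 * safety h s a"
        using elim q by (simp add: mult_right_mono_neg)
      also have "\<dots> \<le> safe_value h s + \<epsilon>"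
        using n0 safe_value_nonneg[OF _ s safe] h \<open>0 \<le> \<epsilon>\<close> by simp
      finally show ?case .
    qed
  qed
  then have "\<forall>\<^sub>F n in sequentially. \<forall>a\<in>actions M. ?Q n a \<le> safe_value h s + \<epsilon>"
    by (intro eventually_ball_finite finite_actions) blast
  then show ?thesis
    by (rule eventually_mono) (auto intro!: opt_value_leI[OF h])
qed

lemma eventually_opt_lag_le_safe_value:
  assumes fb: "finitely_branching M" and "1 \<le> h" "s \<in> space (states M)" "safe h s"
  shows "\<forall>\<^sub>F n in sequentially. opt_value M (lag (real n)) h s \<le> safe_value h s"
  using assms(2-)
proof (induction h arbitrary: s rule: backward_induct)
  case (terminal h)
  then show ?case
    by (simp add: opt_value_terminal)
next
  case (step h)
  have "\<forall>\<^sub>F n in sequentially. opt_value M (lag (real n)) h s \<le> safe_value h s + 0"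
  proof (rule eventually_opt_lag_le_step[OF step(1) step.prems order_refl])
    fix a assume a: "a \<in> actions M" "safety h s a = 0"
    note S = safe_action(2)[OF step(1) a(1) step.prems(1) a(2)]
    obtain F where F: "finite F" "AE s' in trans M h s a. s' \<in> F"
      using fb step(1) step.prems(1) a(1) unfolding finitely_branching_def by blast
    let ?F = "{s'\<in>F. s' \<in> space (states M) \<and> safe (Suc h) s'}"
    have "\<forall>\<^sub>F n in sequentially. \<forall>s'\<in>?F. opt_value M (lag (real n)) (Suc h) s' \<le> safe_value (Suc h) s'"
      using F(1) step(2) by (intro eventually_ball_finite) auto
    then show "\<forall>\<^sub>F n in sequentially. (\<integral>s'. opt_value M (lag (real n)) (Suc h) s' \<partial>trans M h s a) \<le>
        (\<integral>s'. safe_value (Suc h) s' \<partial>trans M h s a) + 0"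
    proof eventually_elim
      case (elim n)
      have "AE s' in trans M h s a. opt_value M (lag (real n)) (Suc h) s' \<le> safe_value (Suc h) s'"
        using F(2) S AE_space
        by eventually_elim (use elim trans_space(3)[OF step(1) a(1) step.prems(1)] in auto)
      then show ?case
        using step(1) step.prems(1) a(1)
        by (auto intro!: integral_mono_AE integrable_trans bounded_measurable_opt_value
            stage_function_lag stage_function_penalised)
    qed
  qed
  then show ?case by simp
qed

lemma opt_lag_tendsto_safe_value:
  assumes "1 \<le> h" "s \<in> space (states M)" "safe h s"
  shows "(\<lambda>n. opt_value M (lag (real n)) h s) \<longlonglongrightarrow> safe_value h s"
  using assms
proof (induction h arbitrary: s rule: backward_induct)
  case (terminal h)
  then show ?case
    by (simp add: opt_value_terminal)
next
  case (step h)
  have upper: "\<forall>\<^sub>F n in sequentially. opt_value M (lag (real n)) h s \<le> safe_value h s + \<epsilon>" if "0 < \<epsilon>" for \<epsilon>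
  proof (rule eventually_opt_lag_le_step[OF step(1) step.prems])
    fix a assume a: "a \<in> actions M" "safety h s a = 0"
    note S = safe_action(2)[OF step(1) a(1) step.prems(1) a(2)]
    note T = trans_space[OF step(1) a(1) step.prems(1)]
    interpret P: prob_space "trans M h s a"
      by (rule T)
    note meas = integrable_trans[OF step(1) a(1) step.prems(1), THEN borel_measurable_integrable]
    have "(\<lambda>n. \<integral>s'. opt_value M (lag (real n)) (Suc h) s' \<partial>trans M h s a) \<longlonglongrightarrow>
        (\<integral>s'. safe_value (Suc h) s' \<partial>trans M h s a)"
    proof (rule integral_dominated_convergence[where w="\<lambda>_. real (horizon M)"])
      show "AE s' in trans M h s a. (\<lambda>n. opt_value M (lag (real n)) (Suc h) s') \<longlonglongrightarrow> safe_value (Suc h) s'"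
        using S AE_space by eventually_elim (use step(2) T(3) in auto)
      fix n
      show "AE s' in trans M h s a. norm (opt_value M (lag (real n)) (Suc h) s') \<le> real (horizon M)"
        using S AE_space
      proof eventually_elim
        case (elim s')
        then show ?case
          using safe_value_nonneg[of "Suc h" s'] safe_value_le_opt_lag[of "Suc h" s' "real n"]
            opt_lag_le[of "real n" "Suc h" s'] T(3) by simp
      qed
    qed (auto intro!: meas bounded_measurable_opt_value stage_function_lag stage_function_penalised)
    from order_tendstoD(2)[OF this, of "(\<integral>s'. safe_value (Suc h) s' \<partial>trans M h s a) + \<epsilon>"] that
    show "\<forall>\<^sub>F n in sequentially. (\<integral>s'. opt_value M (lag (real n)) (Suc h) s' \<partial>trans M h s a) \<le>
        (\<integral>s'. safe_value (Suc h) s' \<partial>trans M h s a) + \<epsilon>"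
      by (auto elim: eventually_mono)
  qed (use that in simp)
  have lower: "safe_value h s \<le> opt_value M (lag (real n)) h s" for n
    using step(1) step.prems by (intro safe_value_le_opt_lag) auto
  show ?case
  proof (rule order_tendstoI)
    fix u assume "u < safe_value h s"
    then show "\<forall>\<^sub>F n in sequentially. u < opt_value M (lag (real n)) h s"
      using lower by (intro always_eventually allI) (rule less_le_trans)
  next
    fix u assume u: "safe_value h s < u"
    then have "\<forall>\<^sub>F n in sequentially. opt_value M (lag (real n)) h s \<le> safe_value h s + (u - safe_value h s) / 2"
      by (intro upper) simp
    then show "\<forall>\<^sub>F n in sequentially. opt_value M (lag (real n)) h s < u"
      by (rule eventually_mono) (use u in \<open>simp add: field_simps\<close>)
  qed
qed

lemma dual_fun_ge_safe_value:
  assumes "s \<in> space (states M)" "safe 1 s"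
  shows "safe_value 1 s \<le> dual_fun M s y"
  using safe_value_le_opt_lag[OF _ assms] dual_fun_eq[OF assms(1)] by simp

lemma dual_fun_attained:
  assumes "finitely_branching M" "s \<in> space (states M)" "safe 1 s"
  shows "\<exists>y. is_arg_min (dual_fun M s) (\<lambda>y. 0 \<le> y) y"
proof -
  obtain n where "opt_value M (lag (real n)) 1 s \<le> safe_value 1 s"
    using eventually_opt_lag_le_safe_value[OF assms(1) _ assms(2,3)]
    by (auto dest!: eventually_happens)
  then have "dual_fun M s (real n) \<le> dual_fun M s y" for y
    using dual_fun_ge_safe_value[OF assms(2,3), of y] unfolding dual_fun_eq[OF assms(2), of "real n"]
    by (rule order_trans)
  then have "is_arg_min (dual_fun M s) (\<lambda>y. 0 \<le> y) (real n)"
    by (simp add: is_arg_min_linorder)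
  then show ?thesis by blast
qed

lemma dual_fun_arg_min_eq_safe_value:
  assumes "is_arg_min (dual_fun M s) (\<lambda>y. 0 \<le> y) y" "s \<in> space (states M)" "safe 1 s"
  shows "dual_fun M s y = safe_value 1 s"
proof (rule antisym)
  have "dual_fun M s y \<le> opt_value M (lag (real n)) 1 s" for n
    using assms(1) unfolding dual_fun_eq[OF assms(2), symmetric] by (simp add: is_arg_min_linorder)
  then show "dual_fun M s y \<le> safe_value 1 s"
    using opt_lag_tendsto_safe_value[OF _ assms(2,3)] by (intro LIMSEQ_le_const) auto
qed (rule dual_fun_ge_safe_value[OF assms(2,3)])

end

theorem theorem4p1:
  fixes M :: "('s, 'a) cmdp"
  assumes "reset_cmdp M"
    and dual_attained: "\<And>s. \<not> finitely_branching M \<Longrightarrow> s \<in> space (states M) \<Longrightarrow> feasible M s \<Longrightarrow>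
      \<exists>y. is_arg_min (dual_fun M s) (\<lambda>y. 0 \<le> y) y"
  shows "\<exists>(lamhat :: 's \<Rightarrow> real) pistar. pistar \<in> policies M \<and>
    (\<forall>s\<in>space (states M). feasible M s \<longrightarrow>
      (\<forall>y\<ge>0. \<exists>\<pi>. is_arg_max (\<lambda>\<pi>. lagrangian M s \<pi> y) (\<lambda>\<pi>. \<pi> \<in> policies M) \<pi>) \<and>
      is_arg_min (dual_fun M s) (\<lambda>y. 0 \<le> y) (lamhat s)) \<and>
    (\<forall>\<pi>\<in>policies M. \<forall>lam :: 's \<Rightarrow> real. \<forall>s1\<in>space (states M). feasible M s1 \<longrightarrow>
      policy_value M pistar (reward M) 1 s1 - lam s1 * policy_value M pistar (cost M) 1 s1
        \<ge> policy_value M pistar (reward M) 1 s1 - lamhat s1 * policy_value M pistar (cost M) 1 s1 \<and>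
      policy_value M pistar (reward M) 1 s1 - lamhat s1 * policy_value M pistar (cost M) 1 s1
        \<ge> policy_value M \<pi> (reward M) 1 s1 - lamhat s1 * policy_value M \<pi> (cost M) 1 s1)"
proof -
  interpret reset_cmdp M by fact
  obtain f where f: "greedy penalised f"
    using greedy_exists[OF stage_function_penalised] by blast
  define pistar where "pistar = det_policy f"
  have pistar: "pistar \<in> policies M"
    using f unfolding pistar_def by (intro det_policy_in_policies) (simp add: greedy_def)
  define lamhat where "lamhat s = (SOME y. is_arg_min (dual_fun M s) (\<lambda>y. 0 \<le> y) y)" for s
  have lamhat: "is_arg_min (dual_fun M s) (\<lambda>y. 0 \<le> y) (lamhat s)"
    if s: "s \<in> space (states M)" "feasible M s" for s
    unfolding lamhat_def
  proof (rule someI_ex)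
    show "\<exists>y. is_arg_min (dual_fun M s) (\<lambda>y. 0 \<le> y) y"
      using dual_attained[OF _ s] dual_fun_attained[OF _ s(1) feasible_imp_safe[OF s]]
      by (cases "finitely_branching M") simp_all
  qed
  have arg_max: "\<exists>\<pi>. is_arg_max (\<lambda>\<pi>. lagrangian M s \<pi> y) (\<lambda>\<pi>. \<pi> \<in> policies M) \<pi>"
    if s: "s \<in> space (states M)" for s y
  proof -
    obtain \<pi> where "\<pi> \<in> policies M" "lagrangian M s \<pi> y = opt_value M (lag y) 1 s"
      using lagrangian_attains_opt_value[of y] s by blast
    then show ?thesis
      using lagrangian_le_opt_value[OF _ s] by (auto simp: is_arg_max_def not_less intro!: exI[of _ \<pi>])
  qed
  have cost: "policy_value M pistar (cost M) 1 s = 0"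
    and saddle: "\<pi> \<in> policies M \<Longrightarrow> lagrangian M s \<pi> (lamhat s) \<le> policy_value M pistar (reward M) 1 s"
    if s: "s \<in> space (states M)" "feasible M s" for s \<pi>
  proof -
    note safe = feasible_imp_safe[OF s]
    note V = greedy_penalised_values[OF f order_refl s(1) safe, folded pistar_def]
    show "policy_value M pistar (cost M) 1 s = 0"
      using V by simp
    assume "\<pi> \<in> policies M"
    from lagrangian_le_opt_value[OF this s(1), of "lamhat s"]
    show "lagrangian M s \<pi> (lamhat s) \<le> policy_value M pistar (reward M) 1 s"
      using V dual_fun_arg_min_eq_safe_value[OF lamhat[OF s] s(1) safe] dual_fun_eq[OF s(1)] by simp
  qed
  show ?thesis
    using pistar arg_max lamhat cost saddle
    by (intro exI[of _ lamhat] exI[of _ pistar]) (auto simp: lagrangian_def)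
qed

end
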